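(* Let $d\ge1$ and, for $i=1,\dots,d$, let $G_i$ be a graph that is diagonalisable by a complex Hadamard matrix $H_i$. Then for every $\Omega\subset\mathbb Z_2^d\setminus\{\mathbf 0\}$, the graph $\operatorname{NEPS}(G_1,\dots,G_d;\Omega)$ is diagonalisable by $H_1\otimes\cdots\otimes H_d$.
   Context: Graphs are simple and weighted with non-negative real edge weights (unweighted graphs have all edge weights $1$); $A(G)$ is the matrix of edge weights and $L(G)=D(G)-A(G)$, with $D(G)$ the diagonal matrix of row sums of $A(G)$. A complex Hadamard matrix of order $n$ is an $n\times n$ complex matrix $H$ whose entries all have modulus one and which satisfies $HH^*=nI$. A graph $G$ is diagonalisable by $H$ if every column of $H$ is an eigenvector of $L(G)$. The non-complete extended $p$-sum $\operatorname{NEPS}(G_1,\dots,G_d;\Omega)$ with basis set $\Omega\subset\mathbb Z_2^d\setminus\{\mathbf0\}$ is the graph with vertex set $V(G_1)\times\cdots\times V(G_d)$ and adjacency matrix $A_\Omega=\sum_{\beta\in\Omega}A(G_1)^{\beta_1}\otimes\cdots\otimes A(G_d)^{\beta_d}$, where each $\beta_i\in\{0,1\}$ and $A(G_i)^0=I$; $\otimes$ is the Kronecker product. *)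

theory Defs
  imports Complex_Main
    "Jordan_Normal_Form.Matrix"
    "Jordan_Normal_Form.Char_Poly"
    "Jordan_Normal_Form.Schur_Decomposition"
begin

text \<open>The vertices are listed in an order; row and column \<open>i\<close> of the adjacency matrix belong to
  the vertex \<open>verts G ! i\<close>.\<close>

record 'a wgraph =
  verts :: "'a list"
  adj_mat :: "real mat"

definition order :: "'a wgraph \<Rightarrow> nat" where
  "order G = length (verts G)"

definition weighted_graph :: "'a wgraph \<Rightarrow> bool" where
  "weighted_graph G \<longleftrightarrow>
     distinct (verts G) \<and>
     adj_mat G \<in> carrier_mat (order G) (order G) \<and>
     (\<forall>i<order G. \<forall>j<order G. adj_mat G $$ (i, j) \<ge> 0) \<and>
     (\<forall>i<order G. \<forall>j<order G. adj_mat G $$ (i, j) = adj_mat G $$ (j, i)) \<and>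
     (\<forall>i<order G. adj_mat G $$ (i, i) = 0)"

definition degree_mat :: "'a wgraph \<Rightarrow> real mat" where
  "degree_mat G = mat (order G) (order G)
     (\<lambda>(i, j). if i = j then \<Sum>k<order G. adj_mat G $$ (i, k) else 0)"

definition laplacian :: "'a wgraph \<Rightarrow> real mat" where
  "laplacian G = degree_mat G - adj_mat G"

definition complex_hadamard :: "nat \<Rightarrow> complex mat \<Rightarrow> bool" where
  "complex_hadamard n H \<longleftrightarrow>
     H \<in> carrier_mat n n \<and>
     (\<forall>i<n. \<forall>j<n. cmod (H $$ (i, j)) = 1) \<and>
     H * mat_adjoint H = of_nat n \<cdot>\<^sub>m 1\<^sub>m n"

definition diagonalisable_by :: "'a wgraph \<Rightarrow> complex mat \<Rightarrow> bool" where
  "diagonalisable_by G H \<longleftrightarrow>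
     complex_hadamard (order G) H \<and>
     (\<forall>j<order G. \<exists>\<mu>. eigenvector (map_mat complex_of_real (laplacian G)) (col H j) \<mu>)"

definition kronecker :: "'a :: semiring_1 mat \<Rightarrow> 'a mat \<Rightarrow> 'a mat" where
  "kronecker A B = mat (dim_row A * dim_row B) (dim_col A * dim_col B)
     (\<lambda>(i, j). A $$ (i div dim_row B, j div dim_col B) * B $$ (i mod dim_row B, j mod dim_col B))"

definition kronecker_list :: "'a :: semiring_1 mat list \<Rightarrow> 'a mat" where
  "kronecker_list Ms = foldr kronecker Ms (1\<^sub>m 1)"

text \<open>Elements of \<open>\<int>\<^sub>2\<^sup>d\<close> are used only as exponent vectors, so they are lists of
  natural numbers in \<open>{0, 1}\<close>.\<close>

definition binary_vectors :: "nat \<Rightarrow> nat list set" where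
  "binary_vectors d = {\<beta>. length \<beta> = d \<and> set \<beta> \<subseteq> {0, 1}}"

definition neps_term :: "'a wgraph list \<Rightarrow> nat list \<Rightarrow> real mat" where
  "neps_term Gs \<beta> = kronecker_list (map2 (\<lambda>G b. adj_mat G ^\<^sub>m b) Gs \<beta>)"

text \<open>\<open>product_lists\<close> enumerates the Cartesian product lexicographically, which is the order in
  which \<^const>\<open>kronecker_list\<close> arranges its rows and columns.\<close>

definition neps :: "'a wgraph list \<Rightarrow> nat list set \<Rightarrow> 'a list wgraph" where
  "neps Gs \<Omega> =
     (let vs = product_lists (map verts Gs) in
      \<lparr> verts = vs,
        adj_mat = mat (length vs) (length vs) (\<lambda>(i, j). \<Sum>\<beta>\<in>\<Omega>. neps_term Gs \<beta> $$ (i, j)) \<rparr>)"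

lemma kronecker_list_simps:
  "kronecker_list [] = 1\<^sub>m 1"
  "kronecker_list (A # Ms) = kronecker A (kronecker_list Ms)"
  by (simp_all add: kronecker_list_def)

lemma kronecker_one_right: "kronecker A (1\<^sub>m 1) = A"
  by (rule eq_matI) (auto simp: kronecker_def)

lemma kronecker_list_singleton: "kronecker_list [A] = A"
  by (simp add: kronecker_list_simps kronecker_one_right del: One_nat_def)

lemma length_product_lists_eq: "length (product_lists xss) = (\<Prod>xs\<leftarrow>xss. length xs)"
  by (induction xss) (simp_all add: length_concat comp_def sum_list_triv)

lemma distinct_product_lists_verts:
  "(\<And>xs. xs \<in> set xss \<Longrightarrow> distinct xs) \<Longrightarrow> distinct (product_lists xss)"
proof (induction xss)
  case (Cons xs xss)
  then have "distinct xs" "distinct (product_lists xss)" by auto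
  then show ?case
    by (induction xs) (auto simp: distinct_map)
qed simp

lemma neps_term_Cons:
  "neps_term (G # Gs) (b # \<beta>) = kronecker (adj_mat G ^\<^sub>m b) (neps_term Gs \<beta>)"
  by (simp add: neps_term_def kronecker_list_simps)

lemma adj_power_props:
  assumes "weighted_graph G" "b \<in> {0, 1 :: nat}"
  shows "adj_mat G ^\<^sub>m b \<in> carrier_mat (order G) (order G)"
    and "i < order G \<Longrightarrow> j < order G \<Longrightarrow> (adj_mat G ^\<^sub>m b) $$ (i, j) \<ge> 0"
    and "i < order G \<Longrightarrow> j < order G \<Longrightarrow> (adj_mat G ^\<^sub>m b) $$ (i, j) = (adj_mat G ^\<^sub>m b) $$ (j, i)"
    and "i < order G \<Longrightarrow> b \<noteq> 0 \<Longrightarrow> (adj_mat G ^\<^sub>m b) $$ (i, i) = 0"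
  using assms by (auto simp: weighted_graph_def)

lemma neps_term_props:
  assumes "\<And>G. G \<in> set Gs \<Longrightarrow> weighted_graph G" "\<beta> \<in> binary_vectors (length Gs)"
  defines "n \<equiv> length (product_lists (map verts Gs))"
  shows "neps_term Gs \<beta> \<in> carrier_mat n n \<and>
    (\<forall>i<n. \<forall>j<n. neps_term Gs \<beta> $$ (i, j) \<ge> 0 \<and>
                 neps_term Gs \<beta> $$ (i, j) = neps_term Gs \<beta> $$ (j, i)) \<and>
    (\<beta> \<noteq> replicate (length Gs) 0 \<longrightarrow> (\<forall>i<n. neps_term Gs \<beta> $$ (i, i) = 0))"
  using assms(1,2) unfolding n_def
proof (induction Gs arbitrary: \<beta>)
  case Nil
  then show ?case
    by (auto simp: binary_vectors_def neps_term_def kronecker_list_simps)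
next
  case (Cons G Gs)
  from Cons.prems(2) obtain b \<gamma> where \<beta>: "\<beta> = b # \<gamma>" and b: "b \<in> {0, 1}"
    and \<gamma>: "\<gamma> \<in> binary_vectors (length Gs)"
    by (cases \<beta>) (auto simp: binary_vectors_def)
  have G: "weighted_graph G" using Cons.prems by simp
  define m where "m = length (product_lists (map verts Gs))"
  have IH: "neps_term Gs \<gamma> \<in> carrier_mat m m"
    "\<And>i j. i < m \<Longrightarrow> j < m \<Longrightarrow> neps_term Gs \<gamma> $$ (i, j) \<ge> 0"
    "\<And>i j. i < m \<Longrightarrow> j < m \<Longrightarrow> neps_term Gs \<gamma> $$ (i, j) = neps_term Gs \<gamma> $$ (j, i)"
    "\<And>i. \<gamma> \<noteq> replicate (length Gs) 0 \<Longrightarrow> i < m \<Longrightarrow> neps_term Gs \<gamma> $$ (i, i) = 0"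
    using Cons.IH[OF Cons.prems(1) \<gamma>] unfolding m_def by auto
  note A = adj_power_props[OF G b]
  have n: "length (product_lists (map verts (G # Gs))) = order G * m"
    unfolding length_product_lists_eq m_def order_def by simp
  have div: "i div m < order G" "i mod m < m" if "i < order G * m" for i
    using that by (auto simp: less_mult_imp_div_less intro!: mod_less_divisor) (cases m; simp)
  have entry: "neps_term (G # Gs) \<beta> $$ (i, j) =
      (adj_mat G ^\<^sub>m b) $$ (i div m, j div m) * neps_term Gs \<gamma> $$ (i mod m, j mod m)"
    if "i < order G * m" "j < order G * m" for i j
    using that carrier_matD[OF A(1)] carrier_matD[OF IH(1)]
    by (simp add: \<beta> neps_term_Cons kronecker_def)
  have carr: "neps_term (G # Gs) \<beta> \<in> carrier_mat (order G * m) (order G * m)"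
    using carrier_matD[OF A(1)] carrier_matD[OF IH(1)]
    by (simp add: \<beta> neps_term_Cons kronecker_def)
  have nz: "b \<noteq> 0 \<or> \<gamma> \<noteq> replicate (length Gs) 0" if "\<beta> \<noteq> replicate (length (G # Gs)) 0"
    using that \<beta> by auto
  show ?case
    unfolding n
  proof (intro conjI allI impI)
    fix i j assume ij: "i < order G * m" "j < order G * m"
    show "neps_term (G # Gs) \<beta> $$ (i, j) \<ge> 0"
      unfolding entry[OF ij] using A(2) IH(2) div ij by simp
    show "neps_term (G # Gs) \<beta> $$ (i, j) = neps_term (G # Gs) \<beta> $$ (j, i)"
      unfolding entry[OF ij] entry[OF ij(2,1)]
      using A(3)[of "i div m" "j div m"] IH(3)[of "i mod m" "j mod m"] div ij by simp
  next
    fix i assume "\<beta> \<noteq> replicate (length (G # Gs)) 0" and i: "i < order G * m"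
    then show "neps_term (G # Gs) \<beta> $$ (i, i) = 0"
      unfolding entry[OF i i] using nz A(4)[of "i div m"] IH(4)[of "i mod m"] div[OF i] by auto
  qed (rule carr)
qed

lemma weighted_graph_neps:
  assumes "\<And>G. G \<in> set Gs \<Longrightarrow> weighted_graph G"
    and "\<Omega> \<subseteq> binary_vectors (length Gs) - {replicate (length Gs) 0}"
  shows "weighted_graph (neps Gs \<Omega>)"
proof -
  define n where "n = length (product_lists (map verts Gs))"
  have P: "(\<forall>i<n. \<forall>j<n. neps_term Gs \<beta> $$ (i, j) \<ge> 0 \<and>
                 neps_term Gs \<beta> $$ (i, j) = neps_term Gs \<beta> $$ (j, i)) \<and>
           (\<forall>i<n. neps_term Gs \<beta> $$ (i, i) = 0)" if "\<beta> \<in> \<Omega>" for \<beta>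
    using neps_term_props[OF assms(1), of Gs \<beta>] that assms(2) unfolding n_def by blast
  have "distinct (product_lists (map verts Gs))"
    by (rule distinct_product_lists_verts) (use assms(1) in \<open>auto simp: weighted_graph_def\<close>)
  then show ?thesis
    using P unfolding weighted_graph_def neps_def order_def
    by (auto simp: Let_def n_def intro!: sum_nonneg sum.cong sum.neutral)
qed

end

theory Submission
  imports Defs
begin

text \<open>If \<open>L H = H \<Lambda>\<close> for a complex Hadamard matrix \<open>H\<close> of order \<open>n\<close>, then
  \<open>n L = H \<Lambda> H\<^sup>*\<close>, and since all entries of \<open>H\<close> have modulus one, every diagonal entry of
  \<open>n L\<close> equals the trace of \<open>\<Lambda>\<close>. So the graph is regular, and the columns of \<open>H\<close>
  and the all-ones vector are eigenvectors of its adjacency matrix. Both properties pass to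
  Kronecker products and to sums of matrices; so they hold for the NEPS, which is therefore regular
  with Laplacian \<open>r I - A\<^sub>\<Omega>\<close>.\<close>

section \<open>Index arithmetic of Kronecker products\<close>

text \<open>The map from \<open>k\<close> to \<open>(k div m, k mod m)\<close> is a bijection onto
  pairs, namely block number and position in the block. Every sum over a Kronecker index below is
  split this way.\<close>

lemma sum_div_mod:
  fixes f g :: "nat \<Rightarrow> 'a :: comm_semiring_1"
  shows "(\<Sum>k<n * m. f (k div m) * g (k mod m)) = (\<Sum>k<n. f k) * (\<Sum>k<m. g k)"
proof -
  have "(\<Sum>k<n * m. f (k div m) * g (k mod m)) =
      (\<Sum>i<n. \<Sum>k = i * m..<i * m + m. f (k div m) * g (k mod m))"
    by (rule sum.nat_group[symmetric])
  also have "\<dots> = (\<Sum>i<n. \<Sum>k<m. f i * g k)"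
  proof (rule sum.cong[OF refl])
    fix i
    show "(\<Sum>k = i * m..<i * m + m. f (k div m) * g (k mod m)) = (\<Sum>k<m. f i * g k)"
      by (rule sum.reindex_bij_witness[where i = "\<lambda>k. k + i * m" and j = "\<lambda>k. k - i * m"])
        (auto simp: le_iff_add)
  qed
  finally show ?thesis
    by (simp add: sum_product)
qed

lemma div_mod_less:
  fixes i n m :: nat
  assumes "i < n * m"
  shows "i div m < n" "i mod m < m"
  \<comment> \<open>The bound on the remainder needs \<open>m > 0\<close>; for \<open>m = 0\<close>
    the assumption on \<open>i\<close> is contradictory.\<close>
  using assms by (auto simp: less_mult_imp_div_less intro!: mod_less_divisor) (cases m; simp)

lemma kronecker_carrier:
  assumes "A \<in> carrier_mat n c" "B \<in> carrier_mat m c'"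
  shows "kronecker A B \<in> carrier_mat (n * m) (c * c')"
  using assms by (simp add: kronecker_def)

lemma kronecker_index:
  assumes "A \<in> carrier_mat n c" "B \<in> carrier_mat m c'" "i < n * m" "j < c * c'"
  shows "kronecker A B $$ (i, j) = A $$ (i div m, j div c') * B $$ (i mod m, j mod c')"
  using assms by (simp add: kronecker_def)

lemma kronecker_list_carrier:
  "kronecker_list Ms \<in> carrier_mat (\<Prod>M\<leftarrow>Ms. dim_row M) (\<Prod>M\<leftarrow>Ms. dim_col M)"
  by (induction Ms) (simp_all add: kronecker_list_simps kronecker_def)

section \<open>Hadamard matrices under Kronecker products\<close>

text \<open>Turns the matrix identity into inner products of rows, a form that
  \<open>sum_div_mod\<close> can factor.\<close>

lemma complex_hadamard_iff:
  "complex_hadamard n H \<longleftrightarrow>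
    H \<in> carrier_mat n n \<and>
    (\<forall>i<n. \<forall>j<n. cmod (H $$ (i, j)) = 1) \<and>
    (\<forall>i<n. \<forall>j<n. (\<Sum>k<n. H $$ (i, k) * cnj (H $$ (j, k))) = (if i = j then of_nat n else 0))"
proof (cases "H \<in> carrier_mat n n")
  case True
  have entry: "(H * mat_adjoint H) $$ (i, j) = (\<Sum>k<n. H $$ (i, k) * cnj (H $$ (j, k)))"
    if "i < n" "j < n" for i j
    using True that
    by (auto simp: mat_adjoint_def scalar_prod_def atLeast0LessThan mat_of_rows_index intro!: sum.cong)
  have "H * mat_adjoint H = of_nat n \<cdot>\<^sub>m 1\<^sub>m n \<longleftrightarrow>
      (\<forall>i<n. \<forall>j<n. (H * mat_adjoint H) $$ (i, j) = (if i = j then of_nat n else 0))"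
    using True by (auto simp: mat_eq_iff mat_adjoint_def)
  with True entry show ?thesis
    by (simp add: complex_hadamard_def)
qed (simp add: complex_hadamard_def)

text \<open>Moduli multiply, and an inner product of two rows is an inner product of rows of
  \<open>H\<close> times one of rows of \<open>K\<close>.\<close>

lemma complex_hadamard_kronecker:
  assumes "complex_hadamard n H" "complex_hadamard m K"
  shows "complex_hadamard (n * m) (kronecker H K)"
proof -
  have H: "H \<in> carrier_mat n n" and K: "K \<in> carrier_mat m m"
    using assms by (auto simp: complex_hadamard_def)
  note index = kronecker_index[OF H K]
  have "cmod (kronecker H K $$ (i, j)) = 1" if "i < n * m" "j < n * m" for i j
    using assms div_mod_less[OF that(1)] div_mod_less[OF that(2)] that
    by (simp add: index norm_mult complex_hadamard_def)
  moreover have "(\<Sum>k<n * m. kronecker H K $$ (i, k) * cnj (kronecker H K $$ (j, k))) =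
      (if i = j then of_nat (n * m) else 0)" if "i < n * m" "j < n * m" for i j
  proof -
    have "(\<Sum>k<n * m. kronecker H K $$ (i, k) * cnj (kronecker H K $$ (j, k))) =
      (\<Sum>k<n * m. (H $$ (i div m, k div m) * cnj (H $$ (j div m, k div m))) *
        (K $$ (i mod m, k mod m) * cnj (K $$ (j mod m, k mod m))))"
      using that by (intro sum.cong) (simp_all add: index)
    also have "\<dots> = (\<Sum>k<n. H $$ (i div m, k) * cnj (H $$ (j div m, k))) *
        (\<Sum>k<m. K $$ (i mod m, k) * cnj (K $$ (j mod m, k)))"
      by (rule sum_div_mod)
    also have "\<dots> = (if i div m = j div m then of_nat n else 0) *
        (if i mod m = j mod m then of_nat m else 0)"
      using assms div_mod_less[OF that(1)] div_mod_less[OF that(2)]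
      by (simp add: complex_hadamard_iff)
    \<comment> \<open>Quotient and remainder modulo \<open>m\<close> determine an index, so for
      \<open>i \<noteq> j\<close> at least one factor vanishes.\<close>
    also have "\<dots> = (if i = j then of_nat (n * m) else 0)"
      by (simp, metis div_mult_mod_eq)
    finally show ?thesis .
  qed
  ultimately show ?thesis
    using kronecker_carrier[OF H K] by (simp add: complex_hadamard_iff)
qed

lemma complex_hadamard_kronecker_list:
  assumes "\<And>H. H \<in> set Hs \<Longrightarrow> complex_hadamard (dim_row H) H"
  shows "complex_hadamard (\<Prod>H\<leftarrow>Hs. dim_row H) (kronecker_list Hs)"
  using assms
proof (induction Hs)
  case Nil
  show ?case by (simp add: kronecker_list_simps complex_hadamard_iff)
next
  case (Cons H Hs)
  then show ?case
    by (simp add: kronecker_list_simps complex_hadamard_kronecker)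
qed

section \<open>Matrices with prescribed eigenvector columns\<close>

text \<open>\<open>H\<close> may be rectangular: a Hadamard matrix and the all-ones column are both used.
  Zero columns are allowed.\<close>

definition eigencols :: "real mat \<Rightarrow> complex mat \<Rightarrow> bool" where
  "eigencols M H \<longleftrightarrow>
     M \<in> carrier_mat (dim_row H) (dim_row H) \<and>
     (\<forall>j<dim_col H. \<exists>\<mu>. \<forall>i<dim_row H.
        (\<Sum>k<dim_row H. complex_of_real (M $$ (i, k)) * H $$ (k, j)) = \<mu> * H $$ (i, j))"

text \<open>Serves the NEPS factors with exponent 0, and the empty Kronecker product.\<close>

lemma eigencols_one: "eigencols (1\<^sub>m (dim_row H)) H"
proof -
  have "(\<Sum>k<dim_row H. complex_of_real (1\<^sub>m (dim_row H) $$ (i, k)) * H $$ (k, j)) = 1 * H $$ (i, j)"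
    if "i < dim_row H" for i j
  proof -
    have "(\<Sum>k<dim_row H. complex_of_real (1\<^sub>m (dim_row H) $$ (i, k)) * H $$ (k, j)) =
        (\<Sum>k<dim_row H. if k = i then H $$ (k, j) else 0)"
      using that by (intro sum.cong) auto
    then show ?thesis using that by simp
  qed
  then show ?thesis unfolding eigencols_def by (intro conjI allI impI exI) auto
qed

text \<open>Column \<open>j\<close> of \<open>kronecker H K\<close> is the Kronecker product of
  column \<open>j div c'\<close> of \<open>H\<close> and column \<open>j mod c'\<close> of
  \<open>K\<close>, so by the mixed-product rule the eigenvalues multiply.\<close>

lemma eigencols_kronecker:
  assumes "eigencols M H" "eigencols N K"
  shows "eigencols (kronecker M N) (kronecker H K)"
proof -
  define n m c c' where "n = dim_row H" "m = dim_row K" "c = dim_col H" "c' = dim_col K"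
  have H: "H \<in> carrier_mat n c" and K: "K \<in> carrier_mat m c'"
    by (auto simp: n_m_c_c'_def)
  have M: "M \<in> carrier_mat n n" and N: "N \<in> carrier_mat m m"
    using assms by (auto simp: eigencols_def n_m_c_c'_def)
  have "\<exists>\<mu>. \<forall>i<n * m. (\<Sum>k<n * m. complex_of_real (kronecker M N $$ (i, k)) *
      kronecker H K $$ (k, j)) = \<mu> * kronecker H K $$ (i, j)" if j: "j < c * c'" for j
  proof -
    obtain \<mu> where \<mu>: "\<And>i. i < n \<Longrightarrow>
        (\<Sum>k<n. complex_of_real (M $$ (i, k)) * H $$ (k, j div c')) = \<mu> * H $$ (i, j div c')"
      using assms(1) div_mod_less(1)[OF j] unfolding eigencols_def n_m_c_c'_def by blast
    obtain \<nu> where \<nu>: "\<And>i. i < m \<Longrightarrow>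
        (\<Sum>k<m. complex_of_real (N $$ (i, k)) * K $$ (k, j mod c')) = \<nu> * K $$ (i, j mod c')"
      using assms(2) div_mod_less(2)[OF j] unfolding eigencols_def n_m_c_c'_def by blast
    have "(\<Sum>k<n * m. complex_of_real (kronecker M N $$ (i, k)) * kronecker H K $$ (k, j)) =
        (\<mu> * \<nu>) * kronecker H K $$ (i, j)" if i: "i < n * m" for i
    proof -
      have "(\<Sum>k<n * m. complex_of_real (kronecker M N $$ (i, k)) * kronecker H K $$ (k, j)) =
          (\<Sum>k<n * m. (complex_of_real (M $$ (i div m, k div m)) * H $$ (k div m, j div c')) *
            (complex_of_real (N $$ (i mod m, k mod m)) * K $$ (k mod m, j mod c')))"
        using i j
        by (intro sum.cong) (simp_all add: kronecker_index[OF M N] kronecker_index[OF H K])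
      also have "\<dots> = (\<Sum>k<n. complex_of_real (M $$ (i div m, k)) * H $$ (k, j div c')) *
          (\<Sum>k<m. complex_of_real (N $$ (i mod m, k)) * K $$ (k, j mod c'))"
        by (rule sum_div_mod)
      also have "\<dots> = (\<mu> * \<nu>) * kronecker H K $$ (i, j)"
        using div_mod_less[OF i] i j by (simp add: \<mu> \<nu> kronecker_index[OF H K])
      finally show ?thesis .
    qed
    then show ?thesis by blast
  qed
  then show ?thesis
    using kronecker_carrier[OF M N] carrier_matD[OF kronecker_carrier[OF H K]]
    by (simp add: eigencols_def)
qed

lemma eigencols_kronecker_list:
  assumes "list_all2 eigencols Ms Hs"
  shows "eigencols (kronecker_list Ms) (kronecker_list Hs)"
  using assms
proof (induction rule: list_all2_induct)
  case Nil
  show ?case using eigencols_one[of "1\<^sub>m 1"] by (simp add: kronecker_list_simps)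
qed (simp add: kronecker_list_simps eigencols_kronecker)

text \<open>Each column of \<open>H\<close> is a common eigenvector of all \<open>M x\<close>, so
  its eigenvalues add. For infinite \<open>X\<close> both the matrix and the eigenvalue are 0 by
  default.\<close>

lemma eigencols_sum:
  assumes "\<And>x. x \<in> X \<Longrightarrow> eigencols (M x) H"
  shows "eigencols (mat (dim_row H) (dim_row H) (\<lambda>(i, j). \<Sum>x\<in>X. M x $$ (i, j))) H"
proof -
  define n where "n = dim_row H"
  have "\<exists>\<mu>. \<forall>i<n. (\<Sum>k<n. complex_of_real (\<Sum>x\<in>X. M x $$ (i, k)) * H $$ (k, j)) = \<mu> * H $$ (i, j)"
    if j: "j < dim_col H" for j
  proof -
    have "\<forall>x\<in>X. \<exists>\<mu>. \<forall>i<n.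
        (\<Sum>k<n. complex_of_real (M x $$ (i, k)) * H $$ (k, j)) = \<mu> * H $$ (i, j)"
      using assms j unfolding eigencols_def n_def by blast
    then obtain \<mu> where \<mu>: "\<And>x i. x \<in> X \<Longrightarrow> i < n \<Longrightarrow>
        (\<Sum>k<n. complex_of_real (M x $$ (i, k)) * H $$ (k, j)) = \<mu> x * H $$ (i, j)"
      by (metis bchoice)
    have "(\<Sum>k<n. complex_of_real (\<Sum>x\<in>X. M x $$ (i, k)) * H $$ (k, j)) =
        (\<Sum>x\<in>X. \<mu> x) * H $$ (i, j)" if "i < n" for i
    proof -
      have "(\<Sum>k<n. complex_of_real (\<Sum>x\<in>X. M x $$ (i, k)) * H $$ (k, j)) =
          (\<Sum>x\<in>X. \<Sum>k<n. complex_of_real (M x $$ (i, k)) * H $$ (k, j))"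
        by (simp add: sum_distrib_right) (rule sum.swap)
      then show ?thesis using that by (simp add: \<mu> sum_distrib_right)
    qed
    then show ?thesis by blast
  qed
  then show ?thesis by (simp add: eigencols_def n_def)
qed

section \<open>Regularity through the all-ones vector\<close>

text \<open>A one-column matrix rather than a vector, so that the \<open>eigencols\<close> lemmas
  carry regularity through products and sums.\<close>

definition ones_col :: "nat \<Rightarrow> complex mat" where
  "ones_col n = mat n 1 (\<lambda>_. 1)"

lemma dim_ones_col [simp]: "dim_row (ones_col n) = n" "dim_col (ones_col n) = 1"
  by (simp_all add: ones_col_def)

lemma kronecker_list_ones_col:
  "kronecker_list (map ones_col ns) = ones_col (prod_list ns)"
proof (induction ns)
  case Nil
  show ?case by (rule eq_matI) (auto simp: kronecker_list_simps ones_col_def)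
next
  case (Cons n ns)
  have "kronecker (ones_col n) (ones_col m) = ones_col (n * m)" for m
    by (rule eq_matI) (auto simp: kronecker_def ones_col_def div_mod_less)
  then show ?case using Cons by (simp add: kronecker_list_simps)
qed

text \<open>Applying \<open>A\<close> to the all-ones vector gives the row sums. These are real, so
  a complex eigenvalue they share can be replaced by a real one.\<close>

lemma eigencols_ones_col_iff:
  assumes "A \<in> carrier_mat n n"
  shows "eigencols A (ones_col n) \<longleftrightarrow> (\<exists>r. \<forall>i<n. (\<Sum>k<n. A $$ (i, k)) = r)"
proof -
  have "(\<exists>\<mu>. \<forall>i<n. complex_of_real (f i) = \<mu>) \<longleftrightarrow> (\<exists>r. \<forall>i<n. f i = r)" for f :: "nat \<Rightarrow> real"
    by (metis of_real_eq_iff)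
  then show ?thesis
    using assms by (simp add: eigencols_def ones_col_def flip: of_real_sum)
qed

section \<open>From Laplacian to adjacency matrix\<close>

lemma laplacian_carrier:
  assumes "weighted_graph G"
  shows "laplacian G \<in> carrier_mat (order G) (order G)"
  using assms by (auto simp: laplacian_def degree_mat_def weighted_graph_def)

lemma laplacian_index:
  assumes "weighted_graph G" "i < order G" "j < order G"
  shows "laplacian G $$ (i, j) =
    (if i = j then \<Sum>k<order G. adj_mat G $$ (i, k) else 0) - adj_mat G $$ (i, j)"
  using assms by (auto simp: laplacian_def degree_mat_def weighted_graph_def)

lemma diagonalisable_by_iff:
  assumes "weighted_graph G"
  shows "diagonalisable_by G H \<longleftrightarrow> complex_hadamard (order G) H \<and> eigencols (laplacian G) H"
proof (cases "complex_hadamard (order G) H")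
  case True
  define n where "n = order G"
  have H: "H \<in> carrier_mat n n" and unit: "\<And>i j. i < n \<Longrightarrow> j < n \<Longrightarrow> cmod (H $$ (i, j)) = 1"
    using True by (auto simp: complex_hadamard_def n_def)
  have L: "laplacian G \<in> carrier_mat n n"
    using laplacian_carrier[OF assms] by (simp add: n_def)
  have "eigenvector (map_mat complex_of_real (laplacian G)) (col H j) \<mu> \<longleftrightarrow>
      (\<forall>i<n. (\<Sum>k<n. complex_of_real (laplacian G $$ (i, k)) * H $$ (k, j)) = \<mu> * H $$ (i, j))"
    if j: "j < n" for j \<mu>
  proof -
    \<comment> \<open>\<open>eigenvector\<close> also demands a nonzero column. Entry 0 exists
      because \<open>j < n\<close>, and it has modulus one.\<close>
    have "H $$ (0, j) \<noteq> 0" using unit[of 0 j] j by auto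
    moreover have "col H j $ 0 = H $$ (0, j)" "0\<^sub>v n $ 0 = (0 :: complex)"
      using j H by auto
    ultimately have "col H j \<noteq> 0\<^sub>v n" by metis
    then show ?thesis
      using H L j
      by (simp add: eigenvector_def vec_eq_iff scalar_prod_def atLeast0LessThan)
  qed
  then show ?thesis
    using True H L by (simp add: diagonalisable_by_def eigencols_def flip: n_def)
qed (simp add: diagonalisable_by_def)

lemma diagonalisable_by_imp_regular:
  assumes G: "weighted_graph G" and "diagonalisable_by G H"
  shows "eigencols (adj_mat G) (ones_col (order G))"
proof -
  define n where "n = order G"
  define L where "L = laplacian G"
  have had: "complex_hadamard n H" and eig: "eigencols L H"
    using assms by (auto simp: diagonalisable_by_iff n_def L_def)
  have H: "H \<in> carrier_mat n n" and unit: "\<And>i j. i < n \<Longrightarrow> j < n \<Longrightarrow> cmod (H $$ (i, j)) = 1"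
    using had by (auto simp: complex_hadamard_def)
  have A: "adj_mat G \<in> carrier_mat n n" and A0: "\<And>i. i < n \<Longrightarrow> adj_mat G $$ (i, i) = 0"
    using G by (auto simp: weighted_graph_def n_def)
  obtain \<mu> where \<mu>: "\<And>i j. i < n \<Longrightarrow> j < n \<Longrightarrow>
      (\<Sum>k<n. complex_of_real (L $$ (i, k)) * H $$ (k, j)) = \<mu> j * H $$ (i, j)"
    using eig H unfolding eigencols_def by simp metis
  \<comment> \<open>The common degree is the trace of \<open>\<Lambda>\<close> divided by
    \<open>n\<close>; \<open>Re\<close> makes the witness real.\<close>
  have "(\<Sum>k<n. adj_mat G $$ (i, k)) = Re ((\<Sum>j<n. \<mu> j) / of_nat n)" if i: "i < n" for i
  proof -
    have "complex_of_real (L $$ (i, i)) * of_nat n =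
        (\<Sum>k<n. complex_of_real (L $$ (i, k)) * (if k = i then of_nat n else 0))"
      using i by (simp add: if_distrib sum.delta cong: if_cong)
    \<comment> \<open>Row orthogonality of \<open>H\<close> replaces the delta, which inserts
      \<open>H H\<^sup>*\<close> for \<open>n I\<close>.\<close>
    also have "\<dots> = (\<Sum>k<n. complex_of_real (L $$ (i, k)) * (\<Sum>j<n. H $$ (k, j) * cnj (H $$ (i, j))))"
      using had i by (intro sum.cong) (simp_all add: complex_hadamard_iff)
    also have "\<dots> = (\<Sum>j<n. (\<Sum>k<n. complex_of_real (L $$ (i, k)) * H $$ (k, j)) * cnj (H $$ (i, j)))"
      unfolding sum_distrib_left sum_distrib_right by (subst sum.swap) (simp add: mult.assoc)
    also have "\<dots> = (\<Sum>j<n. \<mu> j * (H $$ (i, j) * cnj (H $$ (i, j))))"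
      using i by (intro sum.cong) (simp_all add: \<mu> mult.assoc)
    also have "\<dots> = (\<Sum>j<n. \<mu> j)"
      using i unit by (intro sum.cong) (simp_all flip: complex_norm_square)
    finally have "complex_of_real (L $$ (i, i)) = (\<Sum>j<n. \<mu> j) / of_nat n"
      using i by (simp add: field_simps)
    \<comment> \<open>Without loops, the Laplacian diagonal is the degree.\<close>
    moreover have "L $$ (i, i) = (\<Sum>k<n. adj_mat G $$ (i, k))"
      using i A0 laplacian_index[OF G] by (simp add: L_def n_def)
    ultimately show ?thesis by (metis Re_complex_of_real)
  qed
  then show ?thesis
    using A unfolding n_def[symmetric] by (subst eigencols_ones_col_iff) auto
qed

text \<open>With \<open>r\<close> the common row sum, the Laplacian is \<open>r I - A\<close>: the
  eigenvectors agree and the eigenvalues correspond by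
  \<open>\<mu> \<mapsto> r - \<mu>\<close>.\<close>

lemma eigencols_laplacian_iff:
  assumes G: "weighted_graph G" and "eigencols (adj_mat G) (ones_col (order G))"
    and "dim_row H = order G"
  shows "eigencols (laplacian G) H \<longleftrightarrow> eigencols (adj_mat G) H"
proof -
  define n where "n = order G"
  have A: "adj_mat G \<in> carrier_mat n n"
    using G by (simp add: weighted_graph_def n_def)
  obtain r where r: "\<And>i. i < n \<Longrightarrow> (\<Sum>k<n. adj_mat G $$ (i, k)) = r"
    using assms(2) A by (auto simp: eigencols_ones_col_iff n_def)
  have L: "(\<Sum>k<n. complex_of_real (laplacian G $$ (i, k)) * H $$ (k, j)) =
      of_real r * H $$ (i, j) - (\<Sum>k<n. complex_of_real (adj_mat G $$ (i, k)) * H $$ (k, j))"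
    if i: "i < n" for i j
  proof -
    have "(\<Sum>k<n. complex_of_real (laplacian G $$ (i, k)) * H $$ (k, j)) =
        (\<Sum>k<n. (if k = i then of_real r * H $$ (k, j) else 0) -
          complex_of_real (adj_mat G $$ (i, k)) * H $$ (k, j))"
      using i r by (intro sum.cong) (auto simp: laplacian_index[OF G] n_def left_diff_distrib)
    then show ?thesis using i by (simp add: sum_subtractf)
  qed
  \<comment> \<open>Here \<open>f\<close> stands for the image of column \<open>j\<close> under the
    adjacency matrix.\<close>
  have "(\<exists>\<mu>. \<forall>i<n. of_real r * H $$ (i, j) - f i = \<mu> * H $$ (i, j)) \<longleftrightarrow>
      (\<exists>\<mu>. \<forall>i<n. f i = \<mu> * H $$ (i, j))" (is "?l \<longleftrightarrow> ?r") for j f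
  proof
    assume ?l
    then obtain \<mu> where "\<forall>i<n. of_real r * H $$ (i, j) - f i = \<mu> * H $$ (i, j)" ..
    then have "\<forall>i<n. f i = (of_real r - \<mu>) * H $$ (i, j)" by (simp add: algebra_simps)
    then show ?r ..
  next
    assume ?r
    then obtain \<mu> where "\<forall>i<n. f i = \<mu> * H $$ (i, j)" ..
    then have "\<forall>i<n. of_real r * H $$ (i, j) - f i = (of_real r - \<mu>) * H $$ (i, j)"
      by (simp add: algebra_simps)
    then show ?l ..
  qed
  then show ?thesis
    using A laplacian_carrier[OF G] assms(3) by (simp add: eigencols_def L flip: n_def)
qed

section \<open>The NEPS\<close>

text \<open>The \<open>Hs\<close> need not be square: the result is applied once to the Hadamard
  matrices and once to the all-ones columns.\<close>

lemma eigencols_adj_neps: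
  assumes "length Hs = length Gs"
    and dims: "\<And>i. i < length Gs \<Longrightarrow> dim_row (Hs ! i) = order (Gs ! i)"
    and eig: "\<And>i. i < length Gs \<Longrightarrow> eigencols (adj_mat (Gs ! i)) (Hs ! i)"
    and \<Omega>: "\<Omega> \<subseteq> binary_vectors (length Gs)"
  shows "eigencols (adj_mat (neps Gs \<Omega>)) (kronecker_list Hs)"
proof -
  have "map dim_row Hs = map order Gs"
    using assms(1) dims by (auto intro: nth_equalityI)
  then have "dim_row (kronecker_list Hs) = length (product_lists (map verts Gs))"
    using carrier_matD(1)[OF kronecker_list_carrier[of Hs]]
    by (simp add: length_product_lists_eq comp_def order_def[abs_def])
  moreover have "eigencols (neps_term Gs \<beta>) (kronecker_list Hs)" if "\<beta> \<in> \<Omega>" for \<beta>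
  proof -
    have \<beta>: "length \<beta> = length Gs" "set \<beta> \<subseteq> {0, 1}"
      using that \<Omega> by (auto simp: binary_vectors_def)
    have "eigencols (adj_mat (Gs ! i) ^\<^sub>m (\<beta> ! i)) (Hs ! i)" if i: "i < length Gs" for i
    proof -
      have A: "adj_mat (Gs ! i) \<in> carrier_mat (dim_row (Hs ! i)) (dim_row (Hs ! i))"
        using eig[OF i] by (simp add: eigencols_def)
      \<comment> \<open>Exponent 0 gives the identity and exponent 1 the adjacency matrix
        itself.\<close>
      have "\<beta> ! i \<in> {0, 1}" using \<beta> i nth_mem[of i \<beta>] by (metis subsetD)
      then show ?thesis
        using eig[OF i] eigencols_one[of "Hs ! i"] A by auto
    qed
    then show ?thesis
      unfolding neps_term_def
      using assms(1) \<beta>(1) by (intro eigencols_kronecker_list) (simp add: list_all2_conv_all_nth)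
  qed
  ultimately show ?thesis
    using eigencols_sum[of \<Omega> "neps_term Gs" "kronecker_list Hs"] by (simp add: neps_def Let_def)
qed

theorem mainTheorem14:
  fixes d :: nat
    and Gs :: "'a wgraph list"
    and Hs :: "complex mat list"
    and \<Omega> :: "nat list set"
  assumes "d \<ge> 1"
    and "length Gs = d" and "length Hs = d"
    and "\<And>i. i < d \<Longrightarrow> weighted_graph (Gs ! i)"
    and "\<And>i. i < d \<Longrightarrow> diagonalisable_by (Gs ! i) (Hs ! i)"
    and "\<Omega> \<subseteq> binary_vectors d - {replicate d 0}"
  shows "diagonalisable_by (neps Gs \<Omega>) (kronecker_list Hs)"
proof -
  \<comment> \<open>Excluding the zero vector from \<open>\<Omega>\<close> keeps the diagonal of the
    sum zero.\<close>
  have wg: "weighted_graph (neps Gs \<Omega>)"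
    using assms(2,4,6) by (intro weighted_graph_neps) (auto simp: in_set_conv_nth)
  have \<Omega>: "\<Omega> \<subseteq> binary_vectors (length Gs)"
    using assms(2,6) by auto
  have had: "complex_hadamard (order (Gs ! i)) (Hs ! i)" if "i < d" for i
    using assms(5)[OF that] by (simp add: diagonalisable_by_def)
  then have dims: "dim_row (Hs ! i) = order (Gs ! i)" if "i < d" for i
    using that by (auto simp: complex_hadamard_def)
  have ord: "order (neps Gs \<Omega>) = prod_list (map order Gs)"
    by (simp add: order_def[abs_def] neps_def Let_def length_product_lists_eq comp_def)
  have "map dim_row Hs = map order Gs"
    using assms(2,3) dims by (auto intro: nth_equalityI)
  moreover have "complex_hadamard (dim_row H) H" if "H \<in> set Hs" for H
    using that had dims assms(3) by (auto simp: in_set_conv_nth)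
  ultimately have hadamard: "complex_hadamard (order (neps Gs \<Omega>)) (kronecker_list Hs)"
    using complex_hadamard_kronecker_list[of Hs] by (simp add: ord)
  have regular: "eigencols (adj_mat (Gs ! i)) (ones_col (order (Gs ! i)))" if "i < d" for i
    using diagonalisable_by_imp_regular assms(4,5) that by blast
  \<comment> \<open>Regularity of each factor moves its Hadamard eigenvectors from the Laplacian to
    the adjacency matrix.\<close>
  have "eigencols (adj_mat (Gs ! i)) (Hs ! i)" if "i < d" for i
    using eigencols_laplacian_iff[OF assms(4) regular dims, OF that that that]
      assms(5)[OF that] diagonalisable_by_iff[OF assms(4)[OF that]] by simp
  then have eig: "eigencols (adj_mat (neps Gs \<Omega>)) (kronecker_list Hs)"
    using assms(2,3) dims \<Omega> by (intro eigencols_adj_neps) auto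
  \<comment> \<open>The all-ones columns of the factors multiply to that of the product, so the NEPS
    is regular and the passage to its Laplacian is available.\<close>
  have "eigencols (adj_mat (neps Gs \<Omega>)) (kronecker_list (map ones_col (map order Gs)))"
    using assms(2) regular \<Omega> by (intro eigencols_adj_neps) auto
  then have "eigencols (adj_mat (neps Gs \<Omega>)) (ones_col (order (neps Gs \<Omega>)))"
    by (simp only: kronecker_list_ones_col ord)
  moreover have "dim_row (kronecker_list Hs) = order (neps Gs \<Omega>)"
    using hadamard by (auto simp: complex_hadamard_def)
  ultimately have "eigencols (laplacian (neps Gs \<Omega>)) (kronecker_list Hs)"
    using eigencols_laplacian_iff[OF wg] eig by blast
  with hadamard show ?thesis
    by (simp add: diagonalisable_by_iff[OF wg])
qed

end
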